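(* There exist a finite alphabet $A$ of constants, a finite set $V$ of variables, and a quadratic word equation $E$ over $A$ and $V$ whose length abstraction $\mathrm{Len}(E)\subseteq \mathbb{N}^{|V|}$ is not Presburger-definable. *)

theory Defs
  imports Main "HOL-Library.FuncSet"
begin

datatype ('a, 'v) symbol = Const 'a | Var 'v

type_synonym ('a, 'v) word_eq = "('a, 'v) symbol list \<times> ('a, 'v) symbol list"

definition word_equation :: "'a set \<Rightarrow> 'v set \<Rightarrow> ('a, 'v) word_eq \<Rightarrow> bool" where
  "word_equation A V E \<longleftrightarrow>
     set (fst E) \<subseteq> Const ` A \<union> Var ` V \<and> set (snd E) \<subseteq> Const ` A \<union> Var ` V"

definition quadratic :: "('a, 'v) word_eq \<Rightarrow> bool" where
  "quadratic E \<longleftrightarrow> (\<forall>x. count_list (fst E @ snd E) (Var x) \<le> 2)"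

fun subst_symbol :: "('v \<Rightarrow> 'a list) \<Rightarrow> ('a, 'v) symbol \<Rightarrow> 'a list" where
  "subst_symbol \<sigma> (Const a) = [a]"
| "subst_symbol \<sigma> (Var x) = \<sigma> x"

definition subst_word :: "('v \<Rightarrow> 'a list) \<Rightarrow> ('a, 'v) symbol list \<Rightarrow> 'a list" where
  "subst_word \<sigma> w = concat (map (subst_symbol \<sigma>) w)"

definition is_solution :: "'a set \<Rightarrow> 'v set \<Rightarrow> ('a, 'v) word_eq \<Rightarrow> ('v \<Rightarrow> 'a list) \<Rightarrow> bool" where
  "is_solution A V E \<sigma> \<longleftrightarrow>
     (\<forall>x\<in>V. \<sigma> x \<in> lists A) \<and> subst_word \<sigma> (fst E) = subst_word \<sigma> (snd E)"

text \<open>Vectors of naturals indexed by \<open>V\<close> are the elements of \<open>V \<rightarrow>\<^sub>E UNIV\<close>.\<close>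

definition Len :: "'a set \<Rightarrow> 'v set \<Rightarrow> ('a, 'v) word_eq \<Rightarrow> ('v \<Rightarrow> nat) set" where
  "Len A V E = {restrict (\<lambda>x. length (\<sigma> x)) V | \<sigma>. is_solution A V E \<sigma>}"

text \<open>First-order formulas over the structure of naturals with \<open>0\<close>, \<open>1\<close>, \<open>+\<close>, \<open>=\<close>, \<open><\<close>,
  with variables named by natural numbers. The remaining connectives and the universal
  quantifier are definable.\<close>

datatype pterm = PVar nat | PZero | POne | PAdd pterm pterm

datatype pform =
    PEq pterm pterm
  | PLess pterm pterm
  | PNot pform
  | PAnd pform pform
  | PEx nat pform

fun eval_pterm :: "(nat \<Rightarrow> nat) \<Rightarrow> pterm \<Rightarrow> nat" where
  "eval_pterm \<nu> (PVar x) = \<nu> x"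
| "eval_pterm \<nu> PZero = 0"
| "eval_pterm \<nu> POne = 1"
| "eval_pterm \<nu> (PAdd s t) = eval_pterm \<nu> s + eval_pterm \<nu> t"

fun eval_pform :: "(nat \<Rightarrow> nat) \<Rightarrow> pform \<Rightarrow> bool" where
  "eval_pform \<nu> (PEq s t) \<longleftrightarrow> eval_pterm \<nu> s = eval_pterm \<nu> t"
| "eval_pform \<nu> (PLess s t) \<longleftrightarrow> eval_pterm \<nu> s < eval_pterm \<nu> t"
| "eval_pform \<nu> (PNot \<phi>) \<longleftrightarrow> \<not> eval_pform \<nu> \<phi>"
| "eval_pform \<nu> (PAnd \<phi> \<psi>) \<longleftrightarrow> eval_pform \<nu> \<phi> \<and> eval_pform \<nu> \<psi>"
| "eval_pform \<nu> (PEx x \<phi>) \<longleftrightarrow> (\<exists>n. eval_pform (\<nu>(x := n)) \<phi>)"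

fun fv_pterm :: "pterm \<Rightarrow> nat set" where
  "fv_pterm (PVar x) = {x}"
| "fv_pterm PZero = {}"
| "fv_pterm POne = {}"
| "fv_pterm (PAdd s t) = fv_pterm s \<union> fv_pterm t"

fun fv_pform :: "pform \<Rightarrow> nat set" where
  "fv_pform (PEq s t) = fv_pterm s \<union> fv_pterm t"
| "fv_pform (PLess s t) = fv_pterm s \<union> fv_pterm t"
| "fv_pform (PNot \<phi>) = fv_pform \<phi>"
| "fv_pform (PAnd \<phi> \<psi>) = fv_pform \<phi> \<union> fv_pform \<psi>"
| "fv_pform (PEx x \<phi>) = fv_pform \<phi> - {x}"

definition presburger_definable :: "nat set \<Rightarrow> (nat \<Rightarrow> nat) set \<Rightarrow> bool" where
  "presburger_definable V S \<longleftrightarrow>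
     (\<exists>\<phi>. fv_pform \<phi> \<subseteq> V \<and> S = {\<nu> \<in> V \<rightarrow>\<^sub>E UNIV. eval_pform \<nu> \<phi>})"

end

theory Submission
  imports
    Defs
    "HOL-Decision_Procs.Cooper"
    "HOL-Computational_Algebra.Primes"
begin

text \<open>
  The equation is \<open>x a b y = y b a x\<close>, whose solutions are the factorizations of central
  Sturmian words. Cancelling the shorter of \<open>x\<close> and \<open>y\<close> performs one step of the subtractive
  Euclidean algorithm on \<open>(|x| + 2, |y| + 2)\<close>, so these two numbers are coprime, and conversely
  every coprime pair arises. If the set of these length pairs were Presburger-definable, then so
  would be the set of primes, as \<open>n + 2\<close> is prime iff it is coprime to \<open>m + 2\<close> for all
  \<open>m < n\<close>. But Cooper's quantifier elimination shows that definable sets of naturals are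
  eventually periodic, and the set of primes is not.
\<close>

hide_const (open) Cooper.A Cooper.E Cooper.C

section \<open>Lengths of solutions\<close>

text \<open>Let \<open>y\<close> be the shorter word, so \<open>x = y @ u\<close>. If
  \<open>u\<close> is empty, the equation forces \<open>a = b\<close>; if \<open>u\<close> is one
  letter, the two numbers are consecutive; otherwise \<open>u = b # a # z\<close>, where
  \<open>z\<close> and \<open>y\<close> solve the same equation and |x| + 2 = (|z| + 2) + (|y| +
  2).\<close>

lemma central_eq_imp_coprime:
  assumes "a \<noteq> b" and "x @ a # b # y = y @ b # a # x"
  shows "coprime (length x + 2) (length y + 2)"
  using assms
proof (induction "length x + length y" arbitrary: a b x y rule: less_induct)
  case less
  have main: "coprime (length x + 2) (length y + 2)"
    if eq: "x @ a # b # y = y @ b # a # x" and ab: "a \<noteq> b" and le: "length y \<le> length x"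
      and IH: "\<And>z. length z < length x \<Longrightarrow> z @ a # b # y = y @ b # a # z \<Longrightarrow>
                 coprime (length z + 2) (length y + 2)"
    for a b :: 'a and x y
  proof -
    have "take (length y) x = y"
      using arg_cong[OF eq, of "take (length y)"] le by simp
    then obtain u where x: "x = y @ u"
      by (metis append_take_drop_id)
    have u: "u @ a # b # y = b # a # y @ u"
      using eq x by simp
    consider "u = []" | c where "u = [c]" | c d z where "u = c # d # z"
      by (metis list.exhaust)
    then show ?thesis
    proof cases
      case 1
      then show ?thesis using u ab by simp
    next
      case 2
      then have "length x + 2 = Suc (length y + 2)" using x by simp
      then show ?thesis by (metis coprime_Suc_left_nat)
    next
      case 3
      then have z: "c = b" "d = a" "z @ a # b # y = y @ b # a # z"
        using u x by simp_all
      then have "coprime (length z + 2) (length y + 2)"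
        using IH[of z] x 3 by simp
      moreover have "length x + 2 = (length z + 2) + (length y + 2)"
        using x 3 by simp
      ultimately show ?thesis
        by (metis coprime_iff_gcd_eq_1 gcd_add1)
    qed
  qed
  show ?case
  proof (cases "length y \<le> length x")
    case True
    show ?thesis
      by (rule main[OF less.prems(2,1) True]) (use less in auto)
  next
    case False
    \<comment> \<open>The equation is unchanged when \<open>x\<close>, \<open>y\<close> and
      \<open>a\<close>, \<open>b\<close> are exchanged together, which reduces this case to the
      other one.\<close>
    have "coprime (length y + 2) (length x + 2)"
    proof (rule main[OF less.prems(2)[symmetric]])
      fix z
      assume "length z < length y" and "z @ b # a # x = x @ a # b # z"
      then show "coprime (length z + 2) (length x + 2)"
        using less.hyps[of x z a b] less.prems(1) by (simp add: coprime_commute)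
    qed (use False less.prems(1) in auto)
    then show ?thesis by (simp add: coprime_commute)
  qed
qed

text \<open>Runs the Euclidean steps backwards: from a solution \<open>z\<close>, \<open>y\<close>
  one obtains the longer solution \<open>y @ b # a # z\<close>, \<open>y\<close>. The recursion ends
  at consecutive numbers, since equal ones, being at least 2, are not coprime.\<close>

lemma coprime_imp_central_eq:
  assumes "coprime (m + 2) (n + 2)"
  shows "\<exists>x\<in>lists {a, b}. \<exists>y\<in>lists {a, b}.
    length x = m \<and> length y = n \<and> x @ a # b # y = y @ b # a # x"
  using assms
proof (induction "m + n" arbitrary: a b m n rule: less_induct)
  case less
  have main: "\<exists>x\<in>lists {a, b}. \<exists>y\<in>lists {a, b}.
      length x = m \<and> length y = n \<and> x @ a # b # y = y @ b # a # x"
    if cop: "coprime (m + 2) (n + 2)" and le: "n \<le> m"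
      and IH: "\<And>k. k < m \<Longrightarrow> coprime (k + 2) (n + 2) \<Longrightarrow> \<exists>x\<in>lists {a, b}. \<exists>y\<in>lists {a, b}.
        length x = k \<and> length y = n \<and> x @ a # b # y = y @ b # a # x"
    for a b :: 'a and m n
  proof -
    consider "m = n" | "m = Suc n" | k where "m = k + (n + 2)"
    proof -
      have "m = n \<or> m = Suc n \<or> m = (m - (n + 2)) + (n + 2)"
        using le by linarith
      then show ?thesis using that by blast
    qed
    then show ?thesis
    proof cases
      case 1
      then show ?thesis using cop by simp
    next
      case 2
      \<comment> \<open>Base solution: \<open>x\<close> and \<open>y\<close> are powers of
        \<open>b\<close>, and both sides read b^m a b^m because m = n + 1.\<close>
      have "replicate n b \<in> lists {a, b}" "replicate m b \<in> lists {a, b}"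
        by (auto simp: lists_eq_set)
      moreover have "replicate m b @ a # b # replicate n b = replicate n b @ b # a # replicate m b"
        using 2 by (simp add: replicate_app_Cons_same)
      ultimately show ?thesis by (metis length_replicate)
    next
      case 3
      then have "m + 2 = (k + 2) + (n + 2)" by simp
      then have "coprime (k + 2) (n + 2)"
        using cop by (metis coprime_iff_gcd_eq_1 gcd_add1)
      then obtain z y where z: "z \<in> lists {a, b}" "y \<in> lists {a, b}" "length z = k" "length y = n"
        "z @ a # b # y = y @ b # a # z"
        using IH[of k] 3 by auto
      then show ?thesis
        using 3 by (intro bexI[of _ "y @ b # a # z"] bexI[of _ y]) auto
    qed
  qed
  show ?case
  proof (cases "n \<le> m")
    case True
    show ?thesis
      by (rule main[OF less.prems True]) (use less.hyps in auto)
  next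
    case False
    have "\<exists>x\<in>lists {b, a}. \<exists>y\<in>lists {b, a}.
        length x = n \<and> length y = m \<and> x @ b # a # y = y @ a # b # x"
    proof (rule main)
      fix k
      assume "k < n" and "coprime (k + 2) (m + 2)"
      then have "\<exists>x\<in>lists {a, b}. \<exists>y\<in>lists {a, b}.
          length x = m \<and> length y = k \<and> x @ a # b # y = y @ b # a # x"
        using less.hyps[of m k a b] by (simp add: coprime_commute)
      then show "\<exists>x\<in>lists {b, a}. \<exists>y\<in>lists {b, a}.
          length x = k \<and> length y = m \<and> x @ b # a # y = y @ a # b # x"
        unfolding insert_commute[of b a] by fastforce
    qed (use False less.prems in \<open>auto simp: coprime_commute\<close>)
    then show ?thesis unfolding insert_commute[of b a] by fastforce
  qed
qed

definition central_eq :: "(nat, nat) word_eq" where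
  "central_eq = ([Var 0, Const 0, Const 1, Var 1], [Var 1, Const 1, Const 0, Var 0])"

lemma Len_central_eq:
  "Len {0, 1} {0, 1} central_eq =
     {\<nu> \<in> {0, 1} \<rightarrow>\<^sub>E UNIV. coprime (\<nu> 0 + 2) (\<nu> 1 + 2)}" (is "?L = ?R")
proof
  show "?L \<subseteq> ?R"
    using central_eq_imp_coprime[of "0 :: nat" 1]
    by (auto simp: Len_def is_solution_def central_eq_def subst_word_def split: if_splits)
next
  show "?R \<subseteq> ?L"
  proof
    fix \<nu> assume \<nu>: "\<nu> \<in> ?R"
    then obtain x y where xy: "x \<in> lists {0 :: nat, 1}" "y \<in> lists {0, 1}"
      "length x = \<nu> 0" "length y = \<nu> 1" "x @ 0 # 1 # y = y @ 1 # 0 # x"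
      using coprime_imp_central_eq[of "\<nu> 0" "\<nu> 1" "0 :: nat" 1] by auto
    define \<sigma> where "\<sigma> = (\<lambda>i :: nat. if i = 0 then x else y)"
    have "is_solution {0, 1} {0, 1} central_eq \<sigma>"
      using xy by (simp add: is_solution_def central_eq_def subst_word_def \<sigma>_def)
    moreover have "\<nu> = restrict (\<lambda>i. length (\<sigma> i)) {0, 1}"
      using \<nu> xy by (auto simp: \<sigma>_def PiE_def extensional_def)
    ultimately show "\<nu> \<in> ?L"
      by (auto simp: Len_def)
  qed
qed

section \<open>Presburger-definable sets of naturals\<close>

text \<open>In the translation to Cooper's formulas, \<open>d\<close> maps variable names to de Bruijn indices.\<close>

fun num_of_pterm :: "(nat \<Rightarrow> nat) \<Rightarrow> pterm \<Rightarrow> num" where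
  "num_of_pterm d (PVar x) = Bound (d x)"
| "num_of_pterm d PZero = Cooper.C 0"
| "num_of_pterm d POne = Cooper.C 1"
| "num_of_pterm d (PAdd s t) = Add (num_of_pterm d s) (num_of_pterm d t)"

text \<open>Cooper's quantifiers range over the integers, so \<open>Ge (Bound 0)\<close> restricts
  the bound variable to naturals. The newly bound name takes index 0 and all others move up by
  one.\<close>

fun fm_of_pform :: "(nat \<Rightarrow> nat) \<Rightarrow> pform \<Rightarrow> fm" where
  "fm_of_pform d (PEq s t) = Eq (Sub (num_of_pterm d s) (num_of_pterm d t))"
| "fm_of_pform d (PLess s t) = Lt (Sub (num_of_pterm d s) (num_of_pterm d t))"
| "fm_of_pform d (PNot \<phi>) = Not (fm_of_pform d \<phi>)"
| "fm_of_pform d (PAnd \<phi> \<psi>) = And (fm_of_pform d \<phi>) (fm_of_pform d \<psi>)"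
| "fm_of_pform d (PEx x \<phi>) =
     Cooper.E (And (Ge (Bound 0)) (fm_of_pform (\<lambda>y. if y = x then 0 else Suc (d y)) \<phi>))"

lemma Inum_num_of_pterm:
  assumes "\<forall>y\<in>fv_pterm t. bs ! d y = int (\<nu> y)"
  shows "Inum bs (num_of_pterm d t) = int (eval_pterm \<nu> t)"
  using assms by (induction t) auto

text \<open>Agreement is required on free variables only, so \<open>d\<close> may be arbitrary
  elsewhere and need not be injective.\<close>

lemma Ifm_fm_of_pform:
  assumes "\<forall>y\<in>fv_pform \<phi>. bs ! d y = int (\<nu> y)"
  shows "Ifm bbs bs (fm_of_pform d \<phi>) \<longleftrightarrow> eval_pform \<nu> \<phi>"
  using assms
proof (induction \<phi> arbitrary: d bs \<nu>)
  case (PEq s t)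
  then show ?case by (simp add: Inum_num_of_pterm[of _ bs d \<nu>])
next
  case (PLess s t)
  then show ?case by (simp add: Inum_num_of_pterm[of _ bs d \<nu>])
next
  case (PNot \<phi>)
  then show ?case by simp
next
  case (PAnd \<phi> \<psi>)
  have "\<forall>y\<in>fv_pform \<phi>. bs ! d y = int (\<nu> y)" "\<forall>y\<in>fv_pform \<psi>. bs ! d y = int (\<nu> y)"
    using PAnd.prems by simp_all
  then show ?case using PAnd.IH[of bs d \<nu>] by simp
next
  case (PEx x \<phi>)
  let ?d = "\<lambda>y. if y = x then 0 else Suc (d y)"
  have "Ifm bbs (int n # bs) (fm_of_pform ?d \<phi>) \<longleftrightarrow> eval_pform (\<nu>(x := n)) \<phi>" for n
    using PEx.prems by (intro PEx.IH) auto
  then have "(\<exists>i\<ge>0. Ifm bbs (i # bs) (fm_of_pform ?d \<phi>)) \<longleftrightarrow> (\<exists>n. eval_pform (\<nu>(x := n)) \<phi>)"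
    by (metis nonneg_int_cases of_nat_0_le_iff)
  then show ?case by simp
qed

section \<open>Eventually periodic predicates and linear constraints\<close>

definition eventually_periodic :: "(nat \<Rightarrow> bool) \<Rightarrow> bool" where
  "eventually_periodic P \<longleftrightarrow> (\<exists>p>0. \<exists>N. \<forall>n\<ge>N. P (n + p) \<longleftrightarrow> P n)"

lemma periodic_mult:
  fixes P :: "nat \<Rightarrow> bool"
  assumes "\<forall>n\<ge>N. P (n + p) \<longleftrightarrow> P n" and "N \<le> n"
  shows "P (n + k * p) \<longleftrightarrow> P n"
proof (induction k)
  case (Suc k)
  have "P (n + k * p + p) \<longleftrightarrow> P (n + k * p)"
    using assms by simp
  with Suc show ?case by (simp add: ac_simps)
qed simp

text \<open>The product of the two periods is a common period beyond both thresholds. Keeping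
  \<open>f\<close> arbitrary covers all binary connectives at once.\<close>

lemma eventually_periodic_combine:
  assumes "eventually_periodic P" "eventually_periodic Q"
  shows "eventually_periodic (\<lambda>n. f (P n) (Q n))"
proof -
  obtain p M where p: "p > 0" "\<forall>n\<ge>M. P (n + p) \<longleftrightarrow> P n"
    using assms(1) by (auto simp: eventually_periodic_def)
  obtain q N where q: "q > 0" "\<forall>n\<ge>N. Q (n + q) \<longleftrightarrow> Q n"
    using assms(2) by (auto simp: eventually_periodic_def)
  have "P (n + p * q) \<longleftrightarrow> P n" "Q (n + p * q) \<longleftrightarrow> Q n" if "n \<ge> max M N" for n
    using periodic_mult[OF p(2), of n q] periodic_mult[OF q(2), of n p] that
    by (simp_all add: mult.commute)
  then show ?thesis
    unfolding eventually_periodic_def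
    using p(1) q(1) by (intro exI[of _ "p * q"] conjI exI[of _ "max M N"]) auto
qed

lemma eventually_periodic_const: "eventually_periodic (\<lambda>n. b)"
  by (auto simp: eventually_periodic_def)

lemma eventually_periodic_Not:
  "eventually_periodic P \<Longrightarrow> eventually_periodic (\<lambda>n. \<not> P n)"
  by (simp add: eventually_periodic_def)

lemma eventually_periodic_linear_less:
  fixes a b :: int
  shows "eventually_periodic (\<lambda>n. a * int n + b < 0)"
proof -
  \<comment> \<open>Once n exceeds |b|, the sign of \<open>a\<close> alone decides the inequality,
    or the expression is constant if \<open>a = 0\<close>; hence period 1.\<close>
  have "(a * int (n + 1) + b < 0) \<longleftrightarrow> (a * int n + b < 0)" if n: "n \<ge> nat \<bar>b\<bar> + 1" for n
  proof -
    have n': "int n > \<bar>b\<bar>" using n by linarith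
    consider "a = 0" | "a \<ge> 1" | "a \<le> -1" by linarith
    then show ?thesis
    proof cases
      case 2
      then have "a * int n \<ge> int n" "a * int (n + 1) \<ge> int (n + 1)"
        by (simp_all add: mult_le_cancel_right1)
      then show ?thesis using n' by linarith
    next
      case 3
      then have "a * int n \<le> (-1) * int n" "a * int (n + 1) \<le> (-1) * int (n + 1)"
        by (intro mult_right_mono; simp)+
      then have "a * int n + b < 0" "a * int (n + 1) + b < 0"
        using n' by auto
      then show ?thesis by simp
    qed simp
  qed
  then show ?thesis
    unfolding eventually_periodic_def by (intro exI[of _ 1]) auto
qed

lemma eventually_periodic_linear_eq:
  fixes a b :: int
  shows "eventually_periodic (\<lambda>n. a * int n + b = 0)"
proof -
  have "(a * int n + b = 0) \<longleftrightarrow> \<not> (a * int n + b < 0) \<and> \<not> ((- a) * int n + (- b) < 0)" for n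
    by auto
  then show ?thesis
    using eventually_periodic_combine[OF eventually_periodic_linear_less[of a b]
        eventually_periodic_linear_less[of "- a" "- b"], of "\<lambda>P Q. \<not> P \<and> \<not> Q"]
    by simp
qed

lemma eventually_periodic_linear_dvd:
  fixes a b i :: int
  shows "eventually_periodic (\<lambda>n. i dvd a * int n + b)"
proof (cases "i = 0")
  case True
  then show ?thesis by (simp add: eventually_periodic_linear_eq)
next
  case False
  \<comment> \<open>Shifting n by |i| changes the value by a multiple of \<open>i\<close>.\<close>
  have "i dvd a * int (n + nat \<bar>i\<bar>) + b \<longleftrightarrow> i dvd a * int n + b" for n
  proof -
    have "a * int (n + nat \<bar>i\<bar>) + b = (a * int n + b) + a * \<bar>i\<bar>"
      by (simp add: algebra_simps)
    moreover have "i dvd a * \<bar>i\<bar>" by simp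
    ultimately show ?thesis by (metis dvd_add_left_iff)
  qed
  then show ?thesis
    unfolding eventually_periodic_def using False by (intro exI[of _ "nat \<bar>i\<bar>"]) auto
qed

section \<open>Formulas with one free variable\<close>

lemma Inum_singleton_linear: "\<exists>a b. \<forall>i. Inum [i] t = a * i + b"
proof (induction t)
  case (C c)
  show ?case by (intro exI[of _ 0] exI[of _ c]) simp
next
  case (Bound k)
  show ?case
  proof (cases k)
    case 0
    then show ?thesis by (intro exI[of _ 1] exI[of _ 0]) simp
  next
    case (Suc j)
    \<comment> \<open>An index past the end of the environment reads \<open>[] ! j\<close>, an
      unspecified integer that does not depend on \<open>i\<close> and so counts as a
      constant.\<close>
    then show ?thesis by (intro exI[of _ 0] exI[of _ "[] ! j"]) simp
  qed
next
  case (CN k c t)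
  then obtain a b where t: "\<forall>i. Inum [i] t = a * i + b" by blast
  show ?case
  proof (cases k)
    case 0
    then show ?thesis
      using t by (intro exI[of _ "c + a"] exI[of _ b]) (simp add: algebra_simps)
  next
    case (Suc j)
    then show ?thesis
      using t by (intro exI[of _ a] exI[of _ "c * [] ! j + b"]) (simp add: algebra_simps)
  qed
next
  case (Neg t)
  then obtain a b where "\<forall>i. Inum [i] t = a * i + b" by blast
  then show ?case by (intro exI[of _ "- a"] exI[of _ "- b"]) simp
next
  case (Add s t)
  then obtain a b a' b' where "\<forall>i. Inum [i] s = a * i + b" "\<forall>i. Inum [i] t = a' * i + b'" by blast
  then show ?case by (intro exI[of _ "a + a'"] exI[of _ "b + b'"]) (simp add: algebra_simps)
next
  case (Sub s t)
  then obtain a b a' b' where "\<forall>i. Inum [i] s = a * i + b" "\<forall>i. Inum [i] t = a' * i + b'" by blast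
  then show ?case by (intro exI[of _ "a - a'"] exI[of _ "b - b'"]) (simp add: algebra_simps)
next
  case (Mul c t)
  then obtain a b where "\<forall>i. Inum [i] t = a * i + b" by blast
  then show ?case by (intro exI[of _ "c * a"] exI[of _ "c * b"]) (simp add: algebra_simps)
qed

lemma eventually_periodic_Inum:
  "eventually_periodic (\<lambda>n. Inum [int n] t < 0)"
  "eventually_periodic (\<lambda>n. Inum [int n] t > 0)"
  "eventually_periodic (\<lambda>n. Inum [int n] t = 0)"
  "eventually_periodic (\<lambda>n. i dvd Inum [int n] t)"
proof -
  obtain a b where t: "\<And>i. Inum [i] t = a * i + b"
    using Inum_singleton_linear by blast
  show "eventually_periodic (\<lambda>n. Inum [int n] t < 0)"
    by (simp add: t eventually_periodic_linear_less)
  have "a * int n + b > 0 \<longleftrightarrow> (- a) * int n + (- b) < 0" for n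
    by auto
  then show "eventually_periodic (\<lambda>n. Inum [int n] t > 0)"
    using eventually_periodic_linear_less[of "- a" "- b"] by (simp add: t)
  show "eventually_periodic (\<lambda>n. Inum [int n] t = 0)"
    by (simp add: t eventually_periodic_linear_eq)
  show "eventually_periodic (\<lambda>n. i dvd Inum [int n] t)"
    by (simp add: t eventually_periodic_linear_dvd)
qed

lemma eventually_periodic_qfree:
  assumes "qfree p"
  shows "eventually_periodic (\<lambda>n. Ifm bbs [int n] p)"
  using assms
proof (induction p)
  case (Le t)
  show ?case
    using eventually_periodic_Not[OF eventually_periodic_Inum(2)[of t]] by (simp add: not_less)
next
  case (Ge t)
  show ?case
    using eventually_periodic_Not[OF eventually_periodic_Inum(1)[of t]] by (simp add: not_less)
qed (auto simp: eventually_periodic_const eventually_periodic_Inum eventually_periodic_Not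
    intro: eventually_periodic_combine)

theorem eventually_periodic_eval_pform:
  assumes "fv_pform \<phi> \<subseteq> {x}"
  shows "eventually_periodic (\<lambda>n. eval_pform (\<nu>(x := n)) \<phi>)"
proof -
  \<comment> \<open>At most \<open>x\<close> is free, so the constant map to index 0 is an adequate
    assignment of indices. \<open>pa\<close> is Cooper's quantifier elimination, and
    \<open>mirqe\<close> states its correctness.\<close>
  have "Ifm [] [int n] (pa (fm_of_pform (\<lambda>_. 0) \<phi>)) \<longleftrightarrow> eval_pform (\<nu>(x := n)) \<phi>" for n
    using assms by (subst mirqe[THEN conjunct1], intro Ifm_fm_of_pform) auto
  moreover have "qfree (pa (fm_of_pform (\<lambda>_. 0) \<phi>))"
    using mirqe by blast
  ultimately show ?thesis
    using eventually_periodic_qfree[of "pa (fm_of_pform (\<lambda>_. 0) \<phi>)" "[]"] by simp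
qed

section \<open>Coprimality is not Presburger-definable\<close>

lemma not_eventually_periodic_prime: "\<not> eventually_periodic (\<lambda>n. prime (n + 2))"
proof
  assume "eventually_periodic (\<lambda>n. prime (n + 2))"
  then obtain p N :: nat where p: "p > 0" "\<forall>n\<ge>N. prime (n + p + 2) \<longleftrightarrow> prime (n + 2)"
    by (auto simp: eventually_periodic_def)
  obtain q :: nat where q: "prime q" "q > N + 2"
    using bigger_prime by blast
  \<comment> \<open>Moving \<open>q\<close> periods on from the prime \<open>q\<close> leads to the
    composite number \<open>q * (p + 1)\<close>.\<close>
  have "prime (q - 2 + q * p + 2) \<longleftrightarrow> prime (q - 2 + 2)"
    using p(2) q(2) by (intro periodic_mult[where P = "\<lambda>n. prime (n + 2)"]) auto
  moreover have "q - 2 + 2 = q" "q - 2 + q * p + 2 = q * (p + 1)"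
    using q(2) by (simp_all add: algebra_simps)
  ultimately have "prime (q * (p + 1))"
    using q(1) by simp
  then show False
    using p(1) q(2) prime_product[of q "p + 1"] by simp
qed

text \<open>As m runs below n, m + 2 runs through 2, ..., n + 1, which includes every divisor of n +
  2 other than 1 and n + 2 itself.\<close>

lemma prime_iff_coprime_less:
  "prime (n + 2) \<longleftrightarrow> (\<forall>m<n. coprime (n + 2) (m + 2))" for n :: nat
proof
  assume "prime (n + 2)"
  then show "\<forall>m<n. coprime (n + 2) (m + 2)"
    by (auto intro!: prime_imp_coprime dest!: dvd_imp_le)
next
  assume *: "\<forall>m<n. coprime (n + 2) (m + 2)"
  show "prime (n + 2)"
  proof (rule prime_nat_iff[THEN iffD2], intro conjI allI impI)
    fix d assume d: "d dvd n + 2"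
    show "d = 1 \<or> d = n + 2"
    proof (rule ccontr)
      assume "\<not> (d = 1 \<or> d = n + 2)"
      moreover have "d \<noteq> 0" "d \<le> n + 2"
        using d by (auto intro: Nat.gr0I dest: dvd_imp_le)
      ultimately have "d - 2 < n" "d - 2 + 2 = d" "d \<noteq> 1"
        by auto
      then have "coprime (n + 2) d"
        using * by metis
      then show False
        using d \<open>d \<noteq> 1\<close> by (metis coprime_absorb_right nat_dvd_1_iff_1)
    qed
  qed simp
qed

lemma coprime_not_presburger_definable:
  "\<not> presburger_definable {0, 1} {\<nu> \<in> {0, 1} \<rightarrow>\<^sub>E UNIV. coprime (\<nu> 0 + 2) (\<nu> 1 + 2)}"
proof
  assume "presburger_definable {0, 1} {\<nu> \<in> {0, 1} \<rightarrow>\<^sub>E UNIV. coprime (\<nu> 0 + 2) (\<nu> 1 + 2)}"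
  then obtain \<phi> where fv: "fv_pform \<phi> \<subseteq> {0, 1}"
    and \<phi>: "{\<nu> \<in> {0, 1} \<rightarrow>\<^sub>E UNIV. coprime (\<nu> 0 + 2) (\<nu> 1 + 2)} =
            {\<nu> \<in> {0, 1} \<rightarrow>\<^sub>E UNIV. eval_pform \<nu> \<phi>}"
    by (auto simp: presburger_definable_def)
  \<comment> \<open>This encodes "for all m < n, \<phi>(n, m)", with variable 0 as n and variable 1
    as m.\<close>
  define \<psi> where "\<psi> = PNot (PEx 1 (PAnd (PLess (PVar 1) (PVar 0)) (PNot \<phi>)))"
  \<comment> \<open>Vectors indexed by \<open>{0, 1}\<close> are \<open>undefined\<close> elsewhere,
    so this base valuation makes the updated one a member of the sets in \<phi>.\<close>
  have "eval_pform ((\<lambda>_. undefined)(0 := n, 1 := m)) \<phi> \<longleftrightarrow> coprime (n + 2) (m + 2)" for n m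
  proof -
    have "(\<lambda>_. undefined)(0 := n, 1 := m) \<in> {0, 1 :: nat} \<rightarrow>\<^sub>E UNIV"
      by (auto simp: PiE_def extensional_def)
    then show ?thesis
      using \<phi>[THEN eqset_imp_iff, of "(\<lambda>_. undefined)(0 := n, 1 := m)"] by simp
  qed
  then have "eval_pform ((\<lambda>_. undefined)(0 := n)) \<psi> \<longleftrightarrow> prime (n + 2)" for n
    unfolding prime_iff_coprime_less by (auto simp: \<psi>_def)
  moreover have "fv_pform \<psi> \<subseteq> {0}"
    using fv by (auto simp: \<psi>_def)
  ultimately show False
    using eventually_periodic_eval_pform[of \<psi> 0 "\<lambda>_. undefined"] not_eventually_periodic_prime
    by simp
qed

theorem theorem1:
  "\<exists>(A :: nat set) (V :: nat set) (E :: (nat, nat) word_eq).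
     finite A \<and> finite V \<and> word_equation A V E \<and> quadratic E \<and>
     \<not> presburger_definable V (Len A V E)"
proof (intro exI conjI)
  show "word_equation {0, 1} {0, 1} central_eq"
    by (auto simp: word_equation_def central_eq_def)
  show "quadratic central_eq"
    by (simp add: quadratic_def central_eq_def)
  show "\<not> presburger_definable {0, 1} (Len {0, 1} {0, 1} central_eq)"
    unfolding Len_central_eq by (rule coprime_not_presburger_definable)
qed simp_all

end
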